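(* Let $M$ be a pointed metric space, $Y$ a Banach space, and $K$ a nonempty compact Hausdorff topological space. If $(M,C(K,Y))$ has the Lip-BPB property witnessed by a function $\eta(\varepsilon)$, then $(M,Y)$ has the Lip-BPB property witnessed by the same function.
   Context: All metric spaces are complete and all Banach spaces are real. A pointed metric space is a metric space $(M,d)$ with a distinguished point $0\in M$. $\mathrm{Lip}_0(M,Y)$ is the Banach space of Lipschitz maps $F\colon M\to Y$ with $F(0)=0$, with norm $\|F\|_L=\sup\{\|F(p)-F(q)\|/d(p,q)\colon p\neq q\}$. $C(K,Y)$ is the Banach space of continuous functions from $K$ to $Y$ with the supremum norm. The pair $(M,Y)$ has the Lip-BPB property witnessed by a function $\varepsilon\mapsto\eta(\varepsilon)>0$ ($\varepsilon>0$) if for every $\varepsilon>0$, every $F\in\mathrm{Lip}_0(M,Y)$ with $\|F\|_L=1$ and all $p\neq q$ in $M$ with $\|F(p)-F(q)\|>(1-\eta(\varepsilon))d(p,q)$, there exist $G\in\mathrm{Lip}_0(M,Y)$ and $r\neq s$ in $M$ with $$\frac{\|G(r)-G(s)\|}{d(r,s)}=\|G\|_L=1,\qquad\|G-F\|_L<\varepsilon,\qquad\frac{d(p,r)+d(q,s)}{d(p,q)}<\varepsilon.$$ *)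

theory Defs
  imports "HOL-Analysis.Analysis"
begin

text \<open>
  The pointed metric space M is a type of class \<^class>\<open>metric_space\<close> together with a
  distinguished element \<open>b\<close>.  Codomains are only required to be normed spaces here, because the
  library registers the type of bounded continuous functions \<open>'k \<Rightarrow>\<^sub>C 'y\<close> as a \<^class>\<open>banach\<close>
  instance only for metric domains \<open>'k\<close>; completeness is imposed where the notions are used.
\<close>

definition Lip0 :: "'m::metric_space \<Rightarrow> ('m \<Rightarrow> 'y::real_normed_vector) set" where
  "Lip0 b = {F. F b = 0 \<and> (\<exists>L. L-lipschitz_on UNIV F)}"

text \<open>
  Inserting 0 only matters when M is a single point: the supremum of the empty set of slopes
  is then 0, as it should be, instead of an unspecified real number.
\<close>

definition lip_norm :: "('m::metric_space \<Rightarrow> 'y::real_normed_vector) \<Rightarrow> real" where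
  "lip_norm F = Sup (insert 0 {norm (F p - F q) / dist p q | p q. p \<noteq> q})"

text \<open>
  The type argument carries the codomain Y, which is not determined by the other arguments.
\<close>

definition lip_bpb ::
    "'m::metric_space \<Rightarrow> 'y::real_normed_vector itself \<Rightarrow> (real \<Rightarrow> real) \<Rightarrow> bool" where
  "lip_bpb b (_ :: 'y itself) \<eta> \<longleftrightarrow>
     (\<forall>\<epsilon>>0. \<eta> \<epsilon> > 0) \<and>
     (\<forall>\<epsilon>>0. \<forall>F :: 'm \<Rightarrow> 'y. F \<in> Lip0 b \<longrightarrow> lip_norm F = 1 \<longrightarrow>
        (\<forall>p q. p \<noteq> q \<longrightarrow> norm (F p - F q) > (1 - \<eta> \<epsilon>) * dist p q \<longrightarrow>
           (\<exists>G \<in> Lip0 b. \<exists>r s. r \<noteq> s \<and>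
              norm (G r - G s) / dist r s = lip_norm G \<and> lip_norm G = 1 \<and>
              lip_norm (\<lambda>x. G x - F x) < \<epsilon> \<and>
              (dist p r + dist q s) / dist p q < \<epsilon>)))"

end

theory Submission
  imports Defs
begin

text \<open>
  Embed \<open>Y\<close> isometrically into \<open>C(K,Y)\<close> as the constant functions and approximate the embedded
  map by some \<open>G\<close> attaining its norm at \<open>r, s\<close>. By compactness \<open>G r - G s\<close> attains its supremum
  norm at some \<open>t \<in> K\<close>; then evaluating \<open>G\<close> at \<open>t\<close>, which does not increase Lipschitz norms,
  gives the required map into \<open>Y\<close>.
\<close>

lemma Lip0_I:
  assumes "F b = 0" "L \<ge> 0" "\<And>p q. norm (F p - F q) \<le> L * dist p q"
  shows "F \<in> Lip0 b"
  using assms unfolding Lip0_def by (auto simp: dist_norm intro!: exI[of _ L] lipschitz_onI)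

lemma Lip0_diff:
  assumes "F \<in> Lip0 b" "G \<in> Lip0 b"
  shows "(\<lambda>x. F x - G x) \<in> Lip0 b"
  using assms unfolding Lip0_def by (auto intro: lipschitz_on_diff)

text \<open>\<open>L \<ge> 0\<close> covers the 0 inserted in \<open>lip_norm\<close>; on a
  one-point space the slope bound alone would allow negative \<open>L\<close>.\<close>

lemma lip_norm_le:
  assumes "L \<ge> 0" "\<And>p q. norm (F p - F q) \<le> L * dist p q"
  shows "lip_norm F \<le> L"
  unfolding lip_norm_def using assms by (intro cSup_least) (auto simp: divide_le_eq)

lemma
  assumes "F \<in> Lip0 b"
  shows lip_norm_nonneg: "lip_norm F \<ge> 0"
    and lip_norm_bound: "norm (F p - F q) \<le> lip_norm F * dist p q"
proof -
  from assms obtain L where L: "L-lipschitz_on UNIV F"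
    unfolding Lip0_def by blast
  \<comment> \<open>A real \<open>Sup\<close> dominates its set only when the set is bounded above;
    any Lipschitz constant bounds the slopes and, being nonnegative, the inserted 0.\<close>
  have bdd: "bdd_above (insert 0 {norm (F p - F q) / dist p q | p q. p \<noteq> q})"
    using lipschitz_onD[OF L] lipschitz_on_nonneg[OF L]
    by (intro bdd_aboveI[of _ L]) (auto simp: divide_le_eq dist_norm[symmetric])
  show "lip_norm F \<ge> 0"
    unfolding lip_norm_def by (rule cSup_upper[OF _ bdd]) simp
  show "norm (F p - F q) \<le> lip_norm F * dist p q"
  proof (cases "p = q")
    case False
    then have "norm (F p - F q) / dist p q \<le> lip_norm F"
      unfolding lip_norm_def by (intro cSup_upper[OF _ bdd]) auto
    with False show ?thesis
      by (simp add: divide_le_eq)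
  qed simp
qed

lemma norm_const_bcontfun_diff:
  fixes x y :: "'y::real_normed_vector"
  shows "norm (const_bcontfun x - const_bcontfun y :: 'k::topological_space \<Rightarrow>\<^sub>C 'y) = norm (x - y)"
proof (rule antisym)
  show "norm (const_bcontfun x - const_bcontfun y :: 'k \<Rightarrow>\<^sub>C 'y) \<le> norm (x - y)"
    by (rule norm_bound) simp
  \<comment> \<open>Evaluating at any single point suffices; \<open>undefined\<close> supplies one,
    since types are nonempty.\<close>
  show "norm (x - y) \<le> norm (const_bcontfun x - const_bcontfun y :: 'k \<Rightarrow>\<^sub>C 'y)"
    using norm_bounded[of "const_bcontfun x - const_bcontfun y :: 'k \<Rightarrow>\<^sub>C 'y" undefined] by simp
qed

lemma lip_norm_const_bcontfun: "lip_norm (\<lambda>x. const_bcontfun (F x)) = lip_norm F"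
  unfolding lip_norm_def norm_const_bcontfun_diff ..

lemma const_bcontfun_Lip0:
  assumes "F \<in> Lip0 b"
  shows "(\<lambda>x. const_bcontfun (F x)) \<in> Lip0 b"
  using assms lip_norm_nonneg[OF assms] lip_norm_bound[OF assms]
  by (intro Lip0_I[of _ _ "lip_norm F"]) (auto simp: norm_const_bcontfun_diff Lip0_def)

text \<open>Evaluation at \<open>t\<close> is linear and does not increase the norm.\<close>

lemma norm_eval_diff_le:
  assumes "H \<in> Lip0 b"
  shows "norm (apply_bcontfun (H p) t - apply_bcontfun (H q) t) \<le> lip_norm H * dist p q"
  using norm_bounded[of "H p - H q" t] lip_norm_bound[OF assms, of p q] by simp

lemma eval_Lip0:
  assumes "H \<in> Lip0 b"
  shows "(\<lambda>x. apply_bcontfun (H x) t) \<in> Lip0 b"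
  using assms lip_norm_nonneg[OF assms] norm_eval_diff_le[OF assms]
  by (intro Lip0_I[of _ _ "lip_norm H"]) (auto simp: Lip0_def)

lemma lip_norm_eval_le:
  assumes "H \<in> Lip0 b"
  shows "lip_norm (\<lambda>x. apply_bcontfun (H x) t) \<le> lip_norm H"
  using lip_norm_nonneg[OF assms] norm_eval_diff_le[OF assms] by (rule lip_norm_le)

text \<open>The pointwise norm is continuous, so it has a maximum on a compact space, and this
  maximum is the supremum norm.\<close>

lemma norm_bcontfun_attained:
  fixes f :: "'k::topological_space \<Rightarrow>\<^sub>C 'y::real_normed_vector"
  assumes "compact (UNIV :: 'k set)"
  obtains t where "norm (apply_bcontfun f t) = norm f"
proof -
  have "continuous_on UNIV (\<lambda>t. norm (apply_bcontfun f t))"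
    by (intro continuous_intros) auto
  from continuous_attains_sup[OF assms _ this]
  obtain t where "\<And>u. norm (apply_bcontfun f u) \<le> norm (apply_bcontfun f t)"
    by auto
  then have "norm f \<le> norm (apply_bcontfun f t)"
    by (rule norm_bound)
  with norm_bounded[of f t] that show thesis
    by force
qed

text \<open>Continuous functions on a compact space are bounded, so
  \<open>'k \<Rightarrow>\<^sub>C 'y\<close> is all of C(K,Y).\<close>

theorem proposition4p6:
  fixes b :: "'m::complete_space"
    and \<eta> :: "real \<Rightarrow> real"
  assumes "compact (UNIV :: 'k::t2_space set)"
    and "lip_bpb b TYPE('k \<Rightarrow>\<^sub>C 'y::banach) \<eta>"
  shows "lip_bpb b TYPE('y) \<eta>"
  unfolding lip_bpb_def
proof (intro conjI allI impI)
  show "\<eta> \<epsilon> > 0" if "\<epsilon> > 0" for \<epsilon>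
    using assms(2) that by (auto simp: lip_bpb_def)
next
  fix \<epsilon> :: real and F :: "'m \<Rightarrow> 'y" and p q :: 'm
  assume "\<epsilon> > 0" and F: "F \<in> Lip0 b" and "lip_norm F = 1" and "p \<noteq> q"
    and "norm (F p - F q) > (1 - \<eta> \<epsilon>) * dist p q"
  define F' :: "'m \<Rightarrow> 'k \<Rightarrow>\<^sub>C 'y" where "F' = (\<lambda>x. const_bcontfun (F x))"
  \<comment> \<open>The embedding preserves every slope, so the hypothesis applies with the same
    \<epsilon>, \<open>p\<close>, \<open>q\<close> and hence the same
    \<open>\<eta> \<epsilon>\<close>.\<close>
  have F': "F' \<in> Lip0 b" "lip_norm F' = 1" "norm (F' p - F' q) > (1 - \<eta> \<epsilon>) * dist p q"
    unfolding F'_def using F \<open>lip_norm F = 1\<close> \<open>norm (F p - F q) > _\<close>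
    by (simp_all add: const_bcontfun_Lip0 lip_norm_const_bcontfun norm_const_bcontfun_diff)
  then have "\<exists>G\<in>Lip0 b. \<exists>r s. r \<noteq> s \<and>
      norm (G r - G s) / dist r s = lip_norm G \<and> lip_norm G = 1 \<and>
      lip_norm (\<lambda>x. G x - F' x) < \<epsilon> \<and> (dist p r + dist q s) / dist p q < \<epsilon>"
    using assms(2)[unfolded lip_bpb_def, THEN conjunct2, rule_format, OF \<open>\<epsilon> > 0\<close> F'(1,2) \<open>p \<noteq> q\<close>]
    by blast
  then obtain G r s where G: "G \<in> Lip0 b" "lip_norm G = 1" and "r \<noteq> s"
    and att: "norm (G r - G s) / dist r s = lip_norm G"
    and close: "lip_norm (\<lambda>x. G x - F' x) < \<epsilon>"
    and near: "(dist p r + dist q s) / dist p q < \<epsilon>"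
    by blast
  obtain t where t: "norm (apply_bcontfun (G r - G s) t) = norm (G r - G s)"
    using norm_bcontfun_attained[OF assms(1)] .
  define g where "g = (\<lambda>x. apply_bcontfun (G x) t)"
  have g: "g \<in> Lip0 b" "lip_norm g \<le> 1"
    unfolding g_def using eval_Lip0[OF G(1)] lip_norm_eval_le[OF G(1), of t] G(2) by simp_all
  have g_att: "norm (g r - g s) / dist r s = 1"
    using t att G(2) unfolding g_def by (metis minus_bcontfun.rep_eq)
  \<comment> \<open>The slope at \<open>r\<close>, \<open>s\<close> gives the lower bound.\<close>
  then have "lip_norm g = 1"
    using lip_norm_bound[OF g(1), of r s] g(2) \<open>r \<noteq> s\<close> by (simp add: divide_eq_eq)
  \<comment> \<open>\<open>F' x\<close> takes the value \<open>F x\<close> everywhere, so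
    \<open>g - F\<close> is \<open>G - F'\<close> evaluated at \<open>t\<close>.\<close>
  moreover have "lip_norm (\<lambda>x. g x - F x) < \<epsilon>"
    using lip_norm_eval_le[OF Lip0_diff[OF G(1) F'(1)], of t] close
    by (simp add: g_def F'_def)
  ultimately show "\<exists>G\<in>Lip0 b. \<exists>r s. r \<noteq> s \<and>
      norm (G r - G s) / dist r s = lip_norm G \<and> lip_norm G = 1 \<and>
      lip_norm (\<lambda>x. G x - F x) < \<epsilon> \<and> (dist p r + dist q s) / dist p q < \<epsilon>"
    using g(1) g_att \<open>r \<noteq> s\<close> near by (intro bexI[of _ g] exI[of _ r] exI[of _ s]) auto
qed

end
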